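(* Let $\{n_d\}_{d\ge 2}\subseteq\mathbb{N}$ be a non-decreasing sequence. For every integer $d\ge 2$ let $\mathbf{U}^{(d)}_1,\ldots,\mathbf{U}^{(d)}_{n_d}$ be i.i.d. $\mathrm{Unif}(S^{d-1})$ random variables and let $\mathbf{L}^{(d)}=(L^{(d)}_1,\ldots,L^{(d)}_{n_d})$ be a random vector of non-negative real random variables, such that $\mathbf{U}^{(d)}_1,\ldots,\mathbf{U}^{(d)}_{n_d}$ and $\mathbf{L}^{(d)}$ are independent, all these random variables (for all $d$) being defined on the same complete probability space $(\Omega,\mathcal{F},\mathbb{P})$. Set $\mathbf{S}_{d,n_d}:=\sum_{k=1}^{n_d}L^{(d)}_k\mathbf{U}^{(d)}_k$. Assume there exist $k\in\mathbb{N}$, $\delta\in(0,1/2)$ and a function $\psi:\mathbb{R}^+\to\mathbb{R}^+$ such that $$\mathbb{E}\left[\left(L^{(d)}_iL^{(d)}_j\right)^k\right]\le\psi(d)\quad\text{for all } d\ge 2 \text{ and all } i\ne j\in\{1,\ldots,n_d\},$$ and such that, for some $\gamma>0$, $$\lim_{d\to+\infty}d^{\,1+\gamma-(1/2-\delta)k}\,\psi(d)\,n_d^{2k+2}=0\quad\text{and}\quad\lim_{d\to+\infty}d^{\,1+\gamma}\,n_d^{2}\exp\left\{-\frac{d-3}{2d^{1-\delta}}\right\}=0.$$ Then $$\mathbb{P}\left(\lim_{d\to+\infty}\left(|\mathbf{S}_{d,n_d}|_2^2-|\mathbf{L}^{(d)}|_2^2\right)=0\right)=1.$$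
   Context: $\mathbb{N}$ denotes the positive integers and $\mathbb{R}^+=[0,\infty)$. $|\cdot|_2$ denotes the Euclidean norm and $S^{d-1}=\{\mathbf{x}\in\mathbb{R}^d: |\mathbf{x}|_2=1\}$. An $\mathbb{R}^d$-valued random variable $\mathbf{V}$ ($d\ge2$) has distribution $\mathrm{Unif}(S^{d-1})$ if there are i.i.d. standard Gaussian real random variables $Z_1,\ldots,Z_d$ such that $\mathbf{V}$ has the same law as $\left(Z_1,\ldots,Z_d\right)/\sqrt{\sum_{h=1}^d Z_h^2}$. The components of $\mathbf{L}^{(d)}$ may be dependent on one another. "$\mathbf{U}^{(d)}_1,\ldots,\mathbf{U}^{(d)}_{n_d}$ and $\mathbf{L}^{(d)}$ are independent" means that these $n_d+1$ random vectors are mutually independent, for each fixed $d$; no assumption is made on the joint law of the variables for different $d$. *)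

theory Defs
  imports "HOL-Probability.Probability"
begin

text \<open>
  The dimension \<open>d\<close> varies inside the statement, so \<open>\<real>\<^sup>d\<close> is rendered by the extensional functions
  \<open>nat \<Rightarrow> real\<close> on the index set \<open>{1..d}\<close>, with the product (Borel) sigma-algebra.
\<close>

abbreviation Rvec :: "nat \<Rightarrow> (nat \<Rightarrow> real) measure" where
  "Rvec d \<equiv> PiM {1..d} (\<lambda>_. borel)"

definition norm2 :: "nat \<Rightarrow> (nat \<Rightarrow> real) \<Rightarrow> real" where
  "norm2 d x = sqrt (\<Sum>j = 1..d. (x j)\<^sup>2)"

text \<open>
  The Gaussian variables may live on a probability space other than \<open>M\<close>; only the laws are
  compared. HOL cannot quantify existentially over the type of that space. The type
  \<open>nat \<Rightarrow> real\<close> loses nothing, since the product of \<open>d\<close> standard Gaussian laws lives on it.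
\<close>

definition unif_sphere :: "'a measure \<Rightarrow> nat \<Rightarrow> ('a \<Rightarrow> nat \<Rightarrow> real) \<Rightarrow> bool" where
  "unif_sphere M d V \<longleftrightarrow>
     V \<in> measurable M (Rvec d) \<and>
     (\<exists>(N :: (nat \<Rightarrow> real) measure) (Z :: nat \<Rightarrow> (nat \<Rightarrow> real) \<Rightarrow> real).
        prob_space N \<and>
        prob_space.indep_vars N (\<lambda>_. borel) Z {1..d} \<and>
        (\<forall>h\<in>{1..d}. distributed N lborel (Z h) std_normal_density) \<and>
        distr M (Rvec d) V =
          distr N (Rvec d) (\<lambda>\<omega>. \<lambda>j\<in>{1..d}. Z j \<omega> / sqrt (\<Sum>h = 1..d. (Z h \<omega>)\<^sup>2)))"

definition rsum :: "nat \<Rightarrow> nat \<Rightarrow> (nat \<Rightarrow> real) \<Rightarrow> (nat \<Rightarrow> nat \<Rightarrow> real) \<Rightarrow> nat \<Rightarrow> real" where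
  "rsum d m l u = (\<lambda>j\<in>{1..d}. \<Sum>k = 1..m. l k * u k j)"

end

theory Submission
  imports Defs "HOL-Real_Asymp.Real_Asymp"
begin

text \<open>
  Expanding the square of the norm, the vectors \<open>U d i\<close> being almost surely of norm one, the
  difference \<open>X d\<close> of the two squared norms is the sum over \<open>i \<noteq> j\<close> of \<open>L d i * L d j\<close> times the
  scalar product of \<open>U d i\<close> and \<open>U d j\<close> (\<open>norm2_rsum_minus_norm2\<close>). In high dimension two independent
  directions are nearly orthogonal: the \<open>k\<close>-th absolute moment of that scalar product is at most
  \<open>C * d powr - (k / 2)\<close>, with \<open>C\<close> depending only on \<open>k\<close>. By independence of \<open>L d\<close>, \<open>U d i\<close> and
  \<open>U d j\<close>, the \<open>k\<close>-th moment of each mixed term is at most \<open>C * d powr - (k / 2) * \<psi> d\<close>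
  (\<open>sphere_pair_moment\<close>), and since there are at most \<open>(n d)\<^sup>2\<close> terms, the \<open>k\<close>-th moment of \<open>X d\<close>
  is at most \<open>(n d) ^ (2 * k + 2)\<close> times that (\<open>spherical_sum_excess_moment\<close>). By the growth condition on
  \<open>\<psi>\<close> and \<open>n\<close> this is eventually at most \<open>C * d powr - (1 + \<gamma>)\<close>, which is summable in \<open>d\<close>. The mean
  of a non-negative series is the sum of the means, whatever the dependence between its terms. Hence
  the sum of \<open>\<bar>X d\<bar> ^ k\<close> over all large \<open>d\<close> has finite mean, and \<open>X d\<close> tends to zero almost surely
  (\<open>AE_tendsto_0_if_summable_moments\<close>).

  For the near orthogonality (\<open>unif_sphere_linear_form_moment\<close>), one of the two vectors is fixed,
  with norm at most one, and the other is represented as a normalized Gaussian vector \<open>Z / norm Z\<close>. The linear form of \<open>Z\<close> has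
  moments bounded independently of \<open>d\<close>, and the squared norm of \<open>Z\<close> is at least \<open>d / 2\<close> outside an event
  of geometrically small probability, on which the normalized linear form is still at most one.
\<close>

section \<open>Exponential moments of Gaussian vectors\<close>

text \<open>
  Completing the square turns \<open>exp (a x)\<close> times the standard density into a multiple of the normal
  density with mean \<open>a\<close>.
\<close>

lemma nn_integral_exp_linear_std_normal:
  assumes "distributed N lborel Z std_normal_density"
  shows "(\<integral>\<^sup>+x. ennreal (exp (a * Z x)) \<partial>N) = ennreal (exp (a\<^sup>2 / 2))"
proof -
  have "std_normal_density x * exp (a * x) = exp (a\<^sup>2 / 2) * normal_density a 1 x" for x
    by (simp add: normal_density_def mult_exp_exp power2_eq_square algebra_simps
        add_divide_distrib diff_divide_distrib)
  then have "ennreal (std_normal_density x) * ennreal (exp (a * x))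
      = ennreal (exp (a\<^sup>2 / 2)) * ennreal (normal_density a 1 x)" for x
    by (simp flip: ennreal_mult)
  then have "(\<integral>\<^sup>+x. ennreal (exp (a * Z x)) \<partial>N)
      = ennreal (exp (a\<^sup>2 / 2)) * (\<integral>\<^sup>+x. ennreal (normal_density a 1 x) \<partial>lborel)"
    using distributed_nn_integral[OF assms, of "\<lambda>x. ennreal (exp (a * x))"]
    by (simp add: nn_integral_cmult)
  then show ?thesis
    by (simp add: nn_integral_eq_integral)
qed

text \<open>
  The product of \<open>exp (- x\<^sup>2 / 2)\<close> and the standard density is a multiple of the centred normal
  density with variance \<open>1/2\<close>.
\<close>

lemma nn_integral_exp_minus_square_std_normal:
  assumes "distributed N lborel Z std_normal_density"
  shows "(\<integral>\<^sup>+x. ennreal (exp (- (Z x)\<^sup>2 / 2)) \<partial>N) = ennreal (1 / sqrt 2)"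
proof -
  have "std_normal_density x * exp (- x\<^sup>2 / 2) = 1 / sqrt 2 * normal_density 0 (1 / sqrt 2) x" for x
    by (simp add: normal_density_def mult_exp_exp power_divide real_sqrt_mult)
  then have "ennreal (std_normal_density x) * ennreal (exp (- x\<^sup>2 / 2))
      = ennreal (1 / sqrt 2) * ennreal (normal_density 0 (1 / sqrt 2) x)" for x
    by (simp flip: ennreal_mult)
  then have "(\<integral>\<^sup>+x. ennreal (exp (- (Z x)\<^sup>2 / 2)) \<partial>N)
      = ennreal (1 / sqrt 2) * (\<integral>\<^sup>+x. ennreal (normal_density 0 (1 / sqrt 2) x) \<partial>lborel)"
    using distributed_nn_integral[OF assms, of "\<lambda>x. ennreal (exp (- x\<^sup>2 / 2))"]
    by (simp add: nn_integral_cmult)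
  then show ?thesis
    by (simp add: nn_integral_eq_integral)
qed

lemma (in prob_space) nn_integral_exp_sum_indep:
  fixes Z :: "'i \<Rightarrow> 'a \<Rightarrow> real"
  assumes "finite I" "indep_vars (\<lambda>_. borel) Z I" "\<And>i. i \<in> I \<Longrightarrow> g i \<in> borel_measurable borel"
  shows "(\<integral>\<^sup>+x. ennreal (exp (\<Sum>i\<in>I. g i (Z i x))) \<partial>M)
    = (\<Prod>i\<in>I. \<integral>\<^sup>+x. ennreal (exp (g i (Z i x))) \<partial>M)"
proof -
  have "indep_vars (\<lambda>_. borel) (\<lambda>i x. ennreal (exp (g i (Z i x)))) I"
    using assms(3) by (intro indep_vars_compose2[OF assms(2)]) simp
  from indep_vars_nn_integral[OF assms(1) this] show ?thesis
    using assms(1) by (simp add: exp_sum prod_ennreal)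
qed

lemma abs_power_le_fact_exp:
  fixes x :: real
  shows "\<bar>x\<bar> ^ k \<le> fact k * (exp x + exp (- x))"
proof -
  have "\<bar>x\<bar> ^ k / fact k \<le> (\<Sum>j\<le>k. \<bar>x\<bar> ^ j / fact j)"
    by (rule member_le_sum) auto
  also have "\<dots> \<le> exp \<bar>x\<bar>"
    using summable_exp[of "\<bar>x\<bar>"]
    by (simp add: exp_def divide_inverse mult.commute sum_le_suminf)
  also have "\<dots> \<le> exp x + exp (- x)"
    by (cases "x \<ge> 0") auto
  finally show ?thesis by (simp add: field_simps)
qed

text \<open>
  The linear form is a centred Gaussian of variance at most one, so its moments are bounded uniformly
  in \<open>d\<close>. The bound goes through the moment generating function, which factorizes even if some
  coefficients vanish; the exact law would require a separate treatment of the degenerate summands.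
\<close>

lemma (in prob_space) gaussian_linear_form_moment:
  fixes Z :: "nat \<Rightarrow> 'a \<Rightarrow> real"
  assumes ind: "indep_vars (\<lambda>_. borel) Z {1..d}"
    and Z: "\<And>h. h \<in> {1..d} \<Longrightarrow> distributed M lborel (Z h) std_normal_density"
    and u: "(\<Sum>j=1..d. (u j)\<^sup>2) \<le> 1"
  shows "(\<integral>\<^sup>+x. ennreal (\<bar>\<Sum>j=1..d. u j * Z j x\<bar> ^ k) \<partial>M) \<le> ennreal (2 * fact k * exp (1/2))"
proof -
  have [measurable]: "random_variable borel (Z j)" if "j \<in> {1..d}" for j
    using ind that by (auto simp: indep_vars_def)
  have mgf: "(\<integral>\<^sup>+x. ennreal (exp (\<Sum>j=1..d. w j * Z j x)) \<partial>M) \<le> ennreal (exp (1/2))"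
    if "(\<Sum>j=1..d. (w j)\<^sup>2) \<le> 1" for w :: "nat \<Rightarrow> real"
  proof -
    have "(\<integral>\<^sup>+x. ennreal (exp (\<Sum>j=1..d. w j * Z j x)) \<partial>M)
        = (\<Prod>j=1..d. \<integral>\<^sup>+x. ennreal (exp (w j * Z j x)) \<partial>M)"
      by (rule nn_integral_exp_sum_indep[OF _ ind]) auto
    also have "\<dots> = (\<Prod>j=1..d. ennreal (exp ((w j)\<^sup>2 / 2)))"
      by (intro prod.cong refl nn_integral_exp_linear_std_normal Z)
    also have "\<dots> = ennreal (exp ((\<Sum>j=1..d. (w j)\<^sup>2) / 2))"
      by (simp add: prod_ennreal exp_sum sum_divide_distrib)
    also have "\<dots> \<le> ennreal (exp (1/2))"
      using that by (intro ennreal_leI) simp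
    finally show ?thesis .
  qed
  let ?X = "\<lambda>x. \<Sum>j=1..d. u j * Z j x"
  have "(\<integral>\<^sup>+x. ennreal (\<bar>?X x\<bar> ^ k) \<partial>M)
      \<le> (\<integral>\<^sup>+x. ennreal (fact k) * (ennreal (exp (?X x)) + ennreal (exp (- ?X x))) \<partial>M)"
    by (intro nn_integral_mono)
      (simp flip: ennreal_mult ennreal_plus add: ennreal_leI abs_power_le_fact_exp)
  also have "\<dots> = ennreal (fact k) *
      ((\<integral>\<^sup>+x. ennreal (exp (?X x)) \<partial>M) + (\<integral>\<^sup>+x. ennreal (exp (- ?X x)) \<partial>M))"
    by (simp add: nn_integral_cmult nn_integral_add)
  also have "\<dots> \<le> ennreal (fact k) * (ennreal (exp (1/2)) + ennreal (exp (1/2)))"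
    using mgf[of u] mgf[of "\<lambda>j. - u j"] u
    by (intro mult_left_mono add_mono) (simp_all add: sum_negf)
  also have "\<dots> = ennreal (2 * fact k * exp (1/2))"
    by (simp flip: ennreal_mult ennreal_plus)
  finally show ?thesis .
qed

text \<open>
  This is the Chernoff bound for the event that the squared norm of a Gaussian vector is at most half
  of its mean \<open>d\<close>: the integrand is at least one on this event. The base
  \<open>exp (1/4) / sqrt 2\<close> is smaller than one, so the bound decays geometrically.
\<close>

lemma (in prob_space) gaussian_norm_exp_moment:
  fixes Z :: "nat \<Rightarrow> 'a \<Rightarrow> real"
  assumes ind: "indep_vars (\<lambda>_. borel) Z {1..d}"
    and Z: "\<And>h. h \<in> {1..d} \<Longrightarrow> distributed M lborel (Z h) std_normal_density"
  shows "(\<integral>\<^sup>+x. ennreal (exp (d / 4 - (\<Sum>h=1..d. (Z h x)\<^sup>2) / 2)) \<partial>M)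
    = ennreal ((exp (1/4) / sqrt 2) ^ d)"
proof -
  have [measurable]: "random_variable borel (Z j)" if "j \<in> {1..d}" for j
    using ind that by (auto simp: indep_vars_def)
  have "(\<integral>\<^sup>+x. ennreal (exp (d / 4 - (\<Sum>h=1..d. (Z h x)\<^sup>2) / 2)) \<partial>M)
      = (\<integral>\<^sup>+x. ennreal (exp (d / 4)) * ennreal (exp (\<Sum>h=1..d. - (Z h x)\<^sup>2 / 2)) \<partial>M)"
    by (simp flip: ennreal_mult add: mult_exp_exp sum_negf sum_divide_distrib)
  also have "\<dots> = ennreal (exp (d / 4)) * (\<Prod>h=1..d. \<integral>\<^sup>+x. ennreal (exp (- (Z h x)\<^sup>2 / 2)) \<partial>M)"
    by (simp add: nn_integral_cmult nn_integral_exp_sum_indep[OF _ ind, of "\<lambda>_ z. - z\<^sup>2 / 2", simplified])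
  also have "\<dots> = ennreal (exp (d / 4)) * (\<Prod>h=1..d. ennreal (1 / sqrt 2))"
    by (intro arg_cong2[where f="(*)"] prod.cong refl nn_integral_exp_minus_square_std_normal Z)
  also have "\<dots> = ennreal (exp (d / 4) * (1 / sqrt 2) ^ d)"
    by (simp add: ennreal_power ennreal_mult)
  also have "exp (d / 4) * (1 / sqrt 2) ^ d = (exp (1/4) / sqrt 2) ^ d"
    using exp_of_nat_mult[of d "1/4 :: real"] by (simp add: power_divide)
  finally show ?thesis .
qed

section \<open>Linear forms of a uniform point of the sphere\<close>

lemma gaussian_tail_le_powr:
  obtains C :: real where "C \<ge> 0"
    "\<And>d. d \<ge> 1 \<Longrightarrow> (exp (1/4) / sqrt 2) ^ d \<le> C * real d powr - (real k / 2)"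
proof -
  let ?q = "exp (1/4) / sqrt 2 :: real"
  \<comment> \<open>The base is below one because \<open>e < 4\<close>.\<close>
  have "exp (1/4) ^ 4 = (exp 1 :: real)"
    by (simp flip: exp_of_nat_mult)
  also have "\<dots> < sqrt 2 ^ 4"
    using exp_le power_mult[of "sqrt 2 :: real" 2 2] by simp
  finally have "exp (1/4) < sqrt (2 :: real)"
    by (rule power_less_imp_less_base) simp
  then have q: "0 < ?q" "?q < 1" by auto
  have "(\<lambda>d. real d powr (real k / 2) * q ^ d) \<longlonglongrightarrow> 0" if "0 < q" "q < 1" for q :: real
    using that by real_asymp
  from this[OF q] have "Bseq (\<lambda>d. real d powr (real k / 2) * ?q ^ d)"
    by (intro convergent_imp_Bseq convergentI)
  then obtain C where C: "C > 0" "\<And>d. norm (real d powr (real k / 2) * ?q ^ d) \<le> C"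
    unfolding Bseq_def by blast
  show thesis
  proof
    show "C \<ge> 0"
      using C(1) by simp
    show "?q ^ d \<le> C * real d powr - (real k / 2)" if "d \<ge> 1" for d
      using C(2)[of d] that by (simp add: powr_minus field_simps)
  qed
qed

text \<open>
  If \<open>R \<ge> d / 2\<close>, then the denominator is at least \<open>sqrt (d / 2)\<close>, which gives the first summand.
  Otherwise Cauchy-Schwarz bounds the left-hand side by one, and the exponential exceeds one.
\<close>

lemma normalized_linear_form_bound:
  fixes u z :: "nat \<Rightarrow> real"
  assumes u: "(\<Sum>j=1..d. (u j)\<^sup>2) \<le> 1" and d: "d \<ge> 1"
  defines "R \<equiv> (\<Sum>h=1..d. (z h)\<^sup>2)"
  shows "\<bar>\<Sum>j=1..d. u j * (z j / sqrt R)\<bar> ^ k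
    \<le> sqrt 2 ^ k * real d powr - (real k / 2) * \<bar>\<Sum>j=1..d. u j * z j\<bar> ^ k + exp (d / 4 - R / 2)"
proof -
  let ?G = "\<Sum>j=1..d. u j * z j"
  have R0: "R \<ge> 0" by (simp add: R_def sum_nonneg)
  have eq: "\<bar>\<Sum>j=1..d. u j * (z j / sqrt R)\<bar> ^ k = (\<bar>?G\<bar> / sqrt R) ^ k"
    using R0 by (simp add: sum_divide_distrib[symmetric] abs_divide)
  show ?thesis
  proof (cases "R \<ge> d / 2")
    case True
    have "(\<bar>?G\<bar> / sqrt R) ^ k \<le> (\<bar>?G\<bar> / sqrt (d / 2)) ^ k"
      using True d by (intro power_mono divide_left_mono) auto
    also have "sqrt d ^ k = real d powr (real k / 2)"
      using d by (simp add: powr_half_sqrt[symmetric] powr_powr flip: powr_realpow)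
    then have "(\<bar>?G\<bar> / sqrt (d / 2)) ^ k = sqrt 2 ^ k * real d powr - (real k / 2) * \<bar>?G\<bar> ^ k"
      by (simp add: real_sqrt_divide power_divide power_mult_distrib powr_minus field_simps)
    finally show ?thesis
      unfolding eq by (smt (verit) exp_gt_zero)
  next
    case False
    have "?G\<^sup>2 \<le> (\<Sum>j=1..d. (u j)\<^sup>2) * R"
      unfolding R_def by (rule Cauchy_Schwarz_ineq_sum)
    also have "\<dots> \<le> R"
      using mult_right_mono[OF u R0] by simp
    finally have "\<bar>?G\<bar> \<le> sqrt R"
      by (simp add: real_le_rsqrt)
    then have "(\<bar>?G\<bar> / sqrt R) ^ k \<le> 1"
      using R0 by (intro power_le_one) (auto simp: divide_le_eq_1)
    also have "1 \<le> exp (d / 4 - R / 2)"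
      using False by simp
    finally show ?thesis
      unfolding eq by (smt (verit) mult_nonneg_nonneg powr_ge_zero zero_le_power abs_ge_zero real_sqrt_ge_zero)
  qed
qed

lemma unif_sphere_nn_integral:
  assumes "unif_sphere M d V" "g \<in> borel_measurable (Rvec d)"
  obtains N :: "(nat \<Rightarrow> real) measure" and Z where
    "prob_space N" "prob_space.indep_vars N (\<lambda>_. borel) Z {1..d}"
    "\<And>h. h \<in> {1..d} \<Longrightarrow> distributed N lborel (Z h) std_normal_density"
    "(\<integral>\<^sup>+x. g (V x) \<partial>M) =
       (\<integral>\<^sup>+\<omega>. g (\<lambda>j\<in>{1..d}. Z j \<omega> / sqrt (\<Sum>h=1..d. (Z h \<omega>)\<^sup>2)) \<partial>N)"
proof -
  from assms(1) obtain N :: "(nat \<Rightarrow> real) measure" and Z where V: "V \<in> measurable M (Rvec d)"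
    and N: "prob_space N" and ind: "prob_space.indep_vars N (\<lambda>_. borel) Z {1..d}"
    and Z: "\<And>h. h \<in> {1..d} \<Longrightarrow> distributed N lborel (Z h) std_normal_density"
    and eq: "distr M (Rvec d) V =
      distr N (Rvec d) (\<lambda>\<omega>. \<lambda>j\<in>{1..d}. Z j \<omega> / sqrt (\<Sum>h = 1..d. (Z h \<omega>)\<^sup>2))"
    unfolding unif_sphere_def by blast
  have [measurable]: "Z j \<in> borel_measurable N" if "j \<in> {1..d}" for j
    using ind that by (auto simp: prob_space.indep_vars_def[OF N])
  have "(\<lambda>\<omega>. \<lambda>j\<in>{1..d}. Z j \<omega> / sqrt (\<Sum>h = 1..d. (Z h \<omega>)\<^sup>2)) \<in> measurable N (Rvec d)"
    by (rule measurable_restrict) measurable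
  then have "(\<integral>\<^sup>+\<omega>. g (\<lambda>j\<in>{1..d}. Z j \<omega> / sqrt (\<Sum>h=1..d. (Z h \<omega>)\<^sup>2)) \<partial>N)
      = integral\<^sup>N (distr M (Rvec d) V) g"
    unfolding eq by (rule nn_integral_distr[symmetric]) (use assms(2) in simp)
  also have "\<dots> = (\<integral>\<^sup>+x. g (V x) \<partial>M)"
    by (rule nn_integral_distr[OF V]) (use assms(2) in simp)
  finally have "(\<integral>\<^sup>+x. g (V x) \<partial>M) =
       (\<integral>\<^sup>+\<omega>. g (\<lambda>j\<in>{1..d}. Z j \<omega> / sqrt (\<Sum>h=1..d. (Z h \<omega>)\<^sup>2)) \<partial>N)"
    by (rule sym)
  from that[OF N ind Z this] show thesis .
qed

text \<open>
  A fixed direction sees only about \<open>1 / sqrt d\<close> of a uniform point of the sphere. The constant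
  depends on \<open>k\<close> alone: the Gaussian linear form has moments bounded in \<open>d\<close>, and the Gaussian norm
  falls below \<open>sqrt (d / 2)\<close> with geometrically small probability.
\<close>

lemma unif_sphere_linear_form_moment:
  obtains C :: real where "C \<ge> 0"
    "\<And>(M :: 'a measure) d V u. \<lbrakk>unif_sphere M d V; d \<ge> 1; (\<Sum>j=1..d. (u j)\<^sup>2) \<le> 1\<rbrakk> \<Longrightarrow>
       (\<integral>\<^sup>+x. ennreal (\<bar>\<Sum>j=1..d. u j * V x j\<bar> ^ k) \<partial>M) \<le> ennreal (C * real d powr - (real k / 2))"
proof -
  from gaussian_tail_le_powr[of k] obtain B :: real where B: "B \<ge> 0"
    "\<And>d. d \<ge> 1 \<Longrightarrow> (exp (1/4) / sqrt 2) ^ d \<le> B * real d powr - (real k / 2)" by blast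
  let ?A = "sqrt 2 ^ k * (2 * fact k * exp (1/2)) :: real"
  have bound: "(\<integral>\<^sup>+x. ennreal (\<bar>\<Sum>j=1..d. u j * V x j\<bar> ^ k) \<partial>M)
      \<le> ennreal ((?A + B) * real d powr - (real k / 2))"
    if V: "unif_sphere M d V" and d: "d \<ge> 1" and u: "(\<Sum>j=1..d. (u j)\<^sup>2) \<le> 1"
    for M :: "'a measure" and d V and u :: "nat \<Rightarrow> real"
  proof -
    let ?p = "real d powr - (real k / 2)"
    let ?f = "\<lambda>v. ennreal (\<bar>\<Sum>j=1..d. u j * v j\<bar> ^ k)"
    have "?f \<in> borel_measurable (Rvec d)" by measurable
    from unif_sphere_nn_integral[OF V this] obtain N :: "(nat \<Rightarrow> real) measure" and Z where
      N: "prob_space N" and ind: "prob_space.indep_vars N (\<lambda>_. borel) Z {1..d}"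
      and Z: "\<And>h. h \<in> {1..d} \<Longrightarrow> distributed N lborel (Z h) std_normal_density"
      and eq: "(\<integral>\<^sup>+x. ?f (V x) \<partial>M) =
        (\<integral>\<^sup>+\<omega>. ?f (\<lambda>j\<in>{1..d}. Z j \<omega> / sqrt (\<Sum>h=1..d. (Z h \<omega>)\<^sup>2)) \<partial>N)" by blast
    interpret N: prob_space N by (rule N)
    have [measurable]: "Z j \<in> borel_measurable N" if "j \<in> {1..d}" for j
      using ind that by (auto simp: N.indep_vars_def)
    let ?R = "\<lambda>\<omega>. \<Sum>h=1..d. (Z h \<omega>)\<^sup>2"
    let ?G = "\<lambda>\<omega>. \<bar>\<Sum>j=1..d. u j * Z j \<omega>\<bar> ^ k"
    have "(\<integral>\<^sup>+x. ?f (V x) \<partial>M)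
        \<le> (\<integral>\<^sup>+\<omega>. ennreal (sqrt 2 ^ k * ?p) * ennreal (?G \<omega>) + ennreal (exp (d / 4 - ?R \<omega> / 2)) \<partial>N)"
      unfolding eq using normalized_linear_form_bound[OF u d]
      by (intro nn_integral_mono) (simp flip: ennreal_mult ennreal_plus add: ennreal_leI)
    also have "\<dots> = ennreal (sqrt 2 ^ k * ?p) * (\<integral>\<^sup>+\<omega>. ennreal (?G \<omega>) \<partial>N)
        + (\<integral>\<^sup>+\<omega>. ennreal (exp (d / 4 - ?R \<omega> / 2)) \<partial>N)"
      by (simp add: nn_integral_add nn_integral_cmult)
    also have "\<dots> \<le> ennreal (sqrt 2 ^ k * ?p) * ennreal (2 * fact k * exp (1/2)) + ennreal (B * ?p)"
      using N.gaussian_norm_exp_moment[OF ind Z] B(2)[OF d]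
      by (intro add_mono mult_left_mono N.gaussian_linear_form_moment[OF ind Z u])
        (simp_all add: ennreal_leI)
    also have "\<dots> = ennreal ((?A + B) * ?p)"
      using B(1) by (simp flip: ennreal_mult ennreal_plus add: algebra_simps)
    finally show ?thesis .
  qed
  have "?A + B \<ge> 0" using B(1) by simp
  from that[OF this bound] show thesis .
qed

text \<open>
  The normalized Gaussian vector has norm one unless the Gaussian vector is zero, where division by
  zero makes it the zero vector; this is a null event since already the first coordinate has a density.
\<close>

lemma unif_sphere_AE_norm:
  assumes V: "unif_sphere M d V" and d: "d \<ge> 1"
  shows "AE x in M. (\<Sum>j=1..d. (V x j)\<^sup>2) = 1"
proof -
  have [measurable]: "V \<in> measurable M (Rvec d)"
    using V by (simp add: unif_sphere_def)
  let ?g = "\<lambda>v. indicator (- {1}) (\<Sum>j=1..d. (v j)\<^sup>2 :: real) :: ennreal"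
  have "?g \<in> borel_measurable (Rvec d)" by measurable
  from unif_sphere_nn_integral[OF V this] obtain N :: "(nat \<Rightarrow> real) measure" and Z where
      N: "prob_space N" and ind: "prob_space.indep_vars N (\<lambda>_. borel) Z {1..d}"
      and Z: "\<And>h. h \<in> {1..d} \<Longrightarrow> distributed N lborel (Z h) std_normal_density"
      and eq: "(\<integral>\<^sup>+x. ?g (V x) \<partial>M) =
        (\<integral>\<^sup>+\<omega>. ?g (\<lambda>j\<in>{1..d}. Z j \<omega> / sqrt (\<Sum>h=1..d. (Z h \<omega>)\<^sup>2)) \<partial>N)" by blast
  have Z1: "distributed N lborel (Z 1) std_normal_density"
    using Z d by simp
  have [measurable]: "Z 1 \<in> borel_measurable N"
    using distributed_measurable[OF Z1] by simp
  have "(\<integral>\<^sup>+\<omega>. indicator {0} (Z 1 \<omega>) \<partial>N)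
      = (\<integral>\<^sup>+x. ennreal (std_normal_density x) * indicator {0} x \<partial>lborel)"
    by (rule distributed_nn_integral[OF Z1, symmetric]) simp
  also have "\<dots> = 0" by simp
  finally have "AE \<omega> in N. indicator {0} (Z 1 \<omega>) = (0 :: ennreal)"
    by (subst (asm) nn_integral_0_iff_AE) (use \<open>Z 1 \<in> borel_measurable N\<close> in measurable)
  then have "AE \<omega> in N. ?g (\<lambda>j\<in>{1..d}. Z j \<omega> / sqrt (\<Sum>h=1..d. (Z h \<omega>)\<^sup>2)) = 0"
  proof eventually_elim
    case (elim \<omega>)
    let ?R = "\<Sum>h=1..d. (Z h \<omega>)\<^sup>2"
    have "0 < (Z 1 \<omega>)\<^sup>2"
      using elim by (auto simp: indicator_def split: if_splits)
    also have "\<dots> \<le> ?R"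
      using d by (intro member_le_sum) auto
    finally have "?R > 0" .
    then have "(\<Sum>j=1..d. (Z j \<omega> / sqrt ?R)\<^sup>2) = 1"
      by (simp add: power_divide flip: sum_divide_distrib)
    then show ?case by simp
  qed
  then have "(\<integral>\<^sup>+x. ?g (V x) \<partial>M) = 0"
    unfolding eq by (simp add: nn_integral_0_iff_AE cong: nn_integral_cong_AE)
  then have "AE x in M. ?g (V x) = 0"
    by (subst (asm) nn_integral_0_iff_AE) auto
  then show ?thesis
    by eventually_elim (auto simp: indicator_def split: if_splits)
qed

section \<open>The mixed terms of the squared norm\<close>

lemma norm2_power2: "(norm2 d x)\<^sup>2 = (\<Sum>j=1..d. (x j)\<^sup>2)"
  by (simp add: norm2_def sum_nonneg)

lemma norm2_rsum_power2: "(norm2 d (rsum d m l u))\<^sup>2 = (\<Sum>h=1..d. (\<Sum>i=1..m. l i * u i h)\<^sup>2)"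
  by (simp add: norm2_power2 rsum_def)

text \<open>
  Expanding the square of the sum, the diagonal terms add up to the squared norm of \<open>l\<close> because each
  \<open>u i\<close> has norm one, and only the mixed terms remain.
\<close>

lemma norm2_rsum_minus_norm2:
  assumes unit: "\<And>i. i \<in> {1..m} \<Longrightarrow> (\<Sum>h=1..d. (u i h)\<^sup>2) = 1"
  shows "(norm2 d (rsum d m l u))\<^sup>2 - (norm2 m l)\<^sup>2
    = (\<Sum>(i, j)\<in>{1..m} \<times> {1..m} - Id. l i * l j * (\<Sum>h=1..d. u i h * u j h))"
    (is "_ = sum ?f _")
proof -
  have "(norm2 d (rsum d m l u))\<^sup>2 = (\<Sum>h=1..d. \<Sum>p\<in>{1..m} \<times> {1..m}. l (fst p) * l (snd p) * (u (fst p) h * u (snd p) h))"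
    unfolding norm2_rsum_power2
    by (simp add: power2_eq_square sum_product sum.cartesian_product split_def mult_ac)
  also have "\<dots> = sum ?f ({1..m} \<times> {1..m})"
    by (subst sum.swap) (simp add: sum_distrib_left split_def)
  also have "{1..m} \<times> {1..m} = ({1..m} \<times> {1..m} - Id) \<union> (\<lambda>i. (i, i)) ` {1..m}"
    by auto
  also have "sum ?f \<dots> = sum ?f ({1..m} \<times> {1..m} - Id) + sum ?f ((\<lambda>i. (i, i)) ` {1..m})"
    by (rule sum.union_disjoint) auto
  also have "sum ?f ((\<lambda>i. (i, i)) ` {1..m}) = (\<Sum>i=1..m. l i * l i * (\<Sum>h=1..d. (u i h)\<^sup>2))"
    by (subst sum.reindex) (auto simp: inj_on_def power2_eq_square)
  also have "\<dots> = (norm2 m l)\<^sup>2"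
    unfolding norm2_power2 using unit by (simp add: power2_eq_square)
  finally show ?thesis by simp
qed

lemma abs_sum_power_le:
  fixes a :: "'b \<Rightarrow> real"
  assumes "finite P" "k \<ge> 1"
  shows "\<bar>sum a P\<bar> ^ k \<le> real (card P) ^ k * (\<Sum>p\<in>P. \<bar>a p\<bar> ^ k)"
proof (cases "P = {}")
  case False
  let ?m = "Max ((\<lambda>p. \<bar>a p\<bar>) ` P)"
  have m: "?m \<in> (\<lambda>p. \<bar>a p\<bar>) ` P" and le: "\<And>p. p \<in> P \<Longrightarrow> \<bar>a p\<bar> \<le> ?m"
    using assms False by (auto intro!: Max_in Max_ge)
  from m obtain q where q: "q \<in> P" "?m = \<bar>a q\<bar>" by blast
  have "\<bar>sum a P\<bar> \<le> (\<Sum>p\<in>P. \<bar>a p\<bar>)"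
    by (rule sum_abs)
  also have "\<dots> \<le> real (card P) * ?m"
    using le by (rule sum_bounded_above)
  finally have "\<bar>sum a P\<bar> \<le> real (card P) * ?m" .
  then have "\<bar>sum a P\<bar> ^ k \<le> real (card P) ^ k * \<bar>a q\<bar> ^ k"
    unfolding q(2) by (metis abs_ge_zero power_mono power_mult_distrib)
  also have "\<bar>a q\<bar> ^ k \<le> (\<Sum>p\<in>P. \<bar>a p\<bar> ^ k)"
    using q(1) assms by (intro member_le_sum) auto
  finally show ?thesis by (simp add: mult_left_mono)
qed (use assms in \<open>simp add: zero_power\<close>)

text \<open>
  Fubini's theorem in the form of conditioning: to bound the mean of a function of two independent
  variables, it suffices to bound its mean over the second one for almost every value of the first.
\<close>

lemma (in prob_space) nn_integral_indep_var_le: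
  assumes ind: "indep_var S X T Y" and F: "F \<in> borel_measurable (S \<Otimes>\<^sub>M T)"
    and le: "AE \<omega> in M. (\<integral>\<^sup>+\<omega>'. F (X \<omega>, Y \<omega>') \<partial>M) \<le> G \<omega>"
  shows "(\<integral>\<^sup>+\<omega>. F (X \<omega>, Y \<omega>) \<partial>M) \<le> (\<integral>\<^sup>+\<omega>. G \<omega> \<partial>M)"
proof -
  have X[measurable]: "random_variable S X" and Y[measurable]: "random_variable T Y"
    and joint: "distr M S X \<Otimes>\<^sub>M distr M T Y = distr M (S \<Otimes>\<^sub>M T) (\<lambda>x. (X x, Y x))"
    using ind unfolding indep_var_distribution_eq by auto
  note [measurable] = F
  interpret DY: prob_space "distr M T Y" by (rule prob_space_distr) (rule Y)
  have "(\<integral>\<^sup>+\<omega>. F (X \<omega>, Y \<omega>) \<partial>M) = (\<integral>\<^sup>+z. F z \<partial>distr M (S \<Otimes>\<^sub>M T) (\<lambda>x. (X x, Y x)))"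
    by (simp add: nn_integral_distr)
  also have "\<dots> = (\<integral>\<^sup>+x. \<integral>\<^sup>+y. F (x, y) \<partial>distr M T Y \<partial>distr M S X)"
    unfolding joint[symmetric] by (rule DY.nn_integral_fst[symmetric]) simp
  also have "\<dots> = (\<integral>\<^sup>+\<omega>. \<integral>\<^sup>+y. F (X \<omega>, y) \<partial>distr M T Y \<partial>M)"
    by (rule nn_integral_distr) measurable
  also have "\<dots> = (\<integral>\<^sup>+\<omega>. \<integral>\<^sup>+\<omega>'. F (X \<omega>, Y \<omega>') \<partial>M \<partial>M)"
    by (intro nn_integral_cong nn_integral_distr) measurable
  also have "\<dots> \<le> (\<integral>\<^sup>+\<omega>. G \<omega> \<partial>M)"
    by (rule nn_integral_mono_AE[OF le])
  finally show ?thesis .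
qed

text \<open>
  Conditionally on \<open>(L, U i)\<close>, the scalar product of \<open>U i\<close> and \<open>U j\<close> is a linear form of \<open>U j\<close> with
  coefficient vector of norm one. Its moment bound does not depend on the condition and factors out.
\<close>

lemma (in prob_space) sphere_pair_moment:
  fixes L :: "'a \<Rightarrow> nat \<Rightarrow> real" and U :: "nat \<Rightarrow> 'a \<Rightarrow> nat \<Rightarrow> real"
  assumes ind: "indep_vars (\<lambda>i. if i = 0 then Rvec m else Rvec d)
      (\<lambda>i. if i = 0 then L else U i) {0..m}"
    and ij: "i \<in> {1..m}" "j \<in> {1..m}" "i \<noteq> j"
    and unit: "AE x in M. (\<Sum>h=1..d. (U i x h)\<^sup>2) = 1"
    and c: "\<And>u. (\<Sum>h=1..d. (u h)\<^sup>2) \<le> 1 \<Longrightarrow>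
      (\<integral>\<^sup>+x. ennreal (\<bar>\<Sum>h=1..d. u h * U j x h\<bar> ^ k) \<partial>M) \<le> ennreal c"
  shows "(\<integral>\<^sup>+x. ennreal (\<bar>L x i * L x j * (\<Sum>h=1..d. U i x h * U j x h)\<bar> ^ k) \<partial>M)
    \<le> ennreal c * (\<integral>\<^sup>+x. ennreal (\<bar>L x i * L x j\<bar> ^ k) \<partial>M)"
proof -
  let ?N = "\<lambda>p. if p = 0 then Rvec m else Rvec d"
  let ?X = "\<lambda>p. if p = 0 then L else U p"
  have rv: "?X p \<in> measurable M (?N p)" if "p \<in> {0..m}" for p
    using ind that unfolding indep_vars_def by blast
  have [measurable]: "L \<in> measurable M (Rvec m)" "U j \<in> measurable M (Rvec d)"
    using rv[of 0] rv[of j] ij by auto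
  have [measurable]: "(\<lambda>x. L x i) \<in> borel_measurable M" "(\<lambda>x. L x j) \<in> borel_measurable M"
    using ij by measurable
  have [measurable]: "(\<lambda>x. U j x h) \<in> borel_measurable M" if "h \<in> {1..d}" for h
    using that by measurable
  \<comment> \<open>The first argument carries \<open>L\<close> at index 0 and \<open>U i\<close> at index \<open>i\<close>, the second \<open>U j\<close> at index \<open>j\<close>.\<close>
  let ?F = "\<lambda>(x, y). ennreal (\<bar>x 0 i * x 0 j * (\<Sum>h=1..d. x i h * y j h)\<bar> ^ k)"
  have i0: "?N i = Rvec d" and j0: "?N j = Rvec d"
    using ij by simp_all
  have [measurable]: "(\<lambda>x. x 0) \<in> measurable (PiM {0, i} ?N) (Rvec m)"
      "(\<lambda>x. x i) \<in> measurable (PiM {0, i} ?N) (Rvec d)"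
      "(\<lambda>y. y j) \<in> measurable (PiM {j} ?N) (Rvec d)"
    using measurable_component_singleton[of 0 "{0, i}" ?N]
      measurable_component_singleton[of i "{0, i}" ?N, unfolded i0]
      measurable_component_singleton[of j "{j}" ?N, unfolded j0] by simp_all
  have F: "?F \<in> borel_measurable (PiM {0, i} ?N \<Otimes>\<^sub>M PiM {j} ?N)"
    using ij by measurable
  have "AE \<omega> in M. (\<integral>\<^sup>+\<omega>'. ?F (\<lambda>p\<in>{0, i}. ?X p \<omega>, \<lambda>p\<in>{j}. ?X p \<omega>') \<partial>M)
      \<le> ennreal c * ennreal (\<bar>L \<omega> i * L \<omega> j\<bar> ^ k)"
    using unit
  proof eventually_elim
    case (elim \<omega>)
    have "(\<integral>\<^sup>+\<omega>'. ?F (\<lambda>p\<in>{0, i}. ?X p \<omega>, \<lambda>p\<in>{j}. ?X p \<omega>') \<partial>M)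
        = (\<integral>\<^sup>+\<omega>'. ennreal (\<bar>L \<omega> i * L \<omega> j\<bar> ^ k) *
            ennreal (\<bar>\<Sum>h=1..d. U i \<omega> h * U j \<omega>' h\<bar> ^ k) \<partial>M)"
      using ij by (simp add: abs_mult power_mult_distrib flip: ennreal_mult)
    also have "\<dots> = ennreal (\<bar>L \<omega> i * L \<omega> j\<bar> ^ k) *
        (\<integral>\<^sup>+\<omega>'. ennreal (\<bar>\<Sum>h=1..d. U i \<omega> h * U j \<omega>' h\<bar> ^ k) \<partial>M)"
      by (rule nn_integral_cmult) measurable
    also have "\<dots> \<le> ennreal (\<bar>L \<omega> i * L \<omega> j\<bar> ^ k) * ennreal c"
      using elim by (intro mult_left_mono c) auto
    finally show ?case by (simp add: mult.commute)
  qed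
  from nn_integral_indep_var_le[OF indep_var_restrict[OF ind] F this]
  have "(\<integral>\<^sup>+\<omega>. ?F (\<lambda>p\<in>{0, i}. ?X p \<omega>, \<lambda>p\<in>{j}. ?X p \<omega>) \<partial>M)
      \<le> (\<integral>\<^sup>+\<omega>. ennreal c * ennreal (\<bar>L \<omega> i * L \<omega> j\<bar> ^ k) \<partial>M)"
    using ij by auto
  then show ?thesis
    using ij by (simp add: nn_integral_cmult)
qed

text \<open>
  There are at most \<open>m\<^sup>2\<close> mixed terms, each with \<open>k\<close>-th moment at most \<open>c * p\<close>. Replacing a sum
  of \<open>N\<close> terms by \<open>N\<close> times the largest one costs a factor \<open>N ^ k\<close>, hence the exponent
  \<open>2 * k + 2\<close> of \<open>m\<close>.
\<close>

lemma (in prob_space) spherical_sum_excess_moment: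
  fixes L :: "'a \<Rightarrow> nat \<Rightarrow> real" and U :: "nat \<Rightarrow> 'a \<Rightarrow> nat \<Rightarrow> real"
  assumes ind: "indep_vars (\<lambda>i. if i = 0 then Rvec m else Rvec d)
      (\<lambda>i. if i = 0 then L else U i) {0..m}"
    and unit: "\<And>i. i \<in> {1..m} \<Longrightarrow> AE x in M. (\<Sum>h=1..d. (U i x h)\<^sup>2) = 1"
    and c: "\<And>i u. i \<in> {1..m} \<Longrightarrow> (\<Sum>h=1..d. (u h)\<^sup>2) \<le> 1 \<Longrightarrow>
      (\<integral>\<^sup>+x. ennreal (\<bar>\<Sum>h=1..d. u h * U i x h\<bar> ^ k) \<partial>M) \<le> ennreal c"
    and p: "\<And>i j. i \<in> {1..m} \<Longrightarrow> j \<in> {1..m} \<Longrightarrow> i \<noteq> j \<Longrightarrow>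
      (\<integral>\<^sup>+x. ennreal (\<bar>L x i * L x j\<bar> ^ k) \<partial>M) \<le> ennreal p"
    and k: "k \<ge> 1" and nonneg: "c \<ge> 0" "p \<ge> 0"
  defines "X \<equiv> \<lambda>x. (norm2 d (rsum d m (L x) (\<lambda>i. U i x)))\<^sup>2 - (norm2 m (L x))\<^sup>2"
  shows "X \<in> borel_measurable M"
    and "(\<integral>\<^sup>+x. ennreal (\<bar>X x\<bar> ^ k) \<partial>M) \<le> ennreal (real m ^ (2 * k + 2) * (c * p))"
proof -
  let ?N = "\<lambda>p. if p = 0 then Rvec m else Rvec d"
  let ?X = "\<lambda>p. if p = 0 then L else U p"
  have rv: "?X p \<in> measurable M (?N p)" if "p \<in> {0..m}" for p
    using ind that unfolding indep_vars_def by blast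
  have L: "L \<in> measurable M (Rvec m)"
    using rv[of 0] by simp
  have U: "U i \<in> measurable M (Rvec d)" if "i \<in> {1..m}" for i
    using rv[of i] that by simp
  have Li[measurable]: "(\<lambda>x. L x i) \<in> borel_measurable M" if "i \<in> {1..m}" for i
    using measurable_compose[OF L measurable_component_singleton[OF that]] .
  have Uih[measurable]: "(\<lambda>x. U i x h) \<in> borel_measurable M" if "i \<in> {1..m}" "h \<in> {1..d}" for i h
    using measurable_compose[OF U[OF that(1)] measurable_component_singleton[OF that(2)]] .
  show "X \<in> borel_measurable M"
    unfolding X_def norm2_rsum_power2 unfolding norm2_power2 by measurable
  let ?P = "{1..m} \<times> {1..m} - Id"
  let ?a = "\<lambda>x (i, j). L x i * L x j * (\<Sum>h=1..d. U i x h * U j x h)"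
  have am: "(\<lambda>x. ennreal (\<bar>?a x q\<bar> ^ k)) \<in> borel_measurable M" if "q \<in> ?P" for q
  proof -
    obtain i j where q: "q = (i, j)" by (cases q)
    with that have "i \<in> {1..m}" "j \<in> {1..m}" by auto
    note [measurable] = this[THEN Li] this[THEN Uih]
    show ?thesis unfolding q split by measurable
  qed
  have "card ?P \<le> card ({1..m} \<times> {1..m})"
    by (intro card_mono) auto
  then have card: "real (card ?P) \<le> real m ^ 2"
    by (simp add: power2_eq_square flip: of_nat_mult)
  have "AE x in M. \<forall>i\<in>{1..m}. (\<Sum>h=1..d. (U i x h)\<^sup>2) = 1"
    using unit by (intro AE_finite_allI) auto
  then have "AE x in M. ennreal (\<bar>X x\<bar> ^ k)
      \<le> ennreal (real (card ?P) ^ k) * (\<Sum>q\<in>?P. ennreal (\<bar>?a x q\<bar> ^ k))"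
  proof eventually_elim
    case (elim x)
    then have "X x = sum (?a x) ?P"
      unfolding X_def by (intro norm2_rsum_minus_norm2) auto
    with k have "\<bar>X x\<bar> ^ k \<le> real (card ?P) ^ k * (\<Sum>q\<in>?P. \<bar>?a x q\<bar> ^ k)"
      by (simp only: abs_sum_power_le finite_SigmaI finite_atLeastAtMost finite_Diff)
    then show ?case
      by (simp add: sum_ennreal sum_nonneg ennreal_leI flip: ennreal_mult)
  qed
  then have "(\<integral>\<^sup>+x. ennreal (\<bar>X x\<bar> ^ k) \<partial>M)
      \<le> (\<integral>\<^sup>+x. ennreal (real (card ?P) ^ k) * (\<Sum>q\<in>?P. ennreal (\<bar>?a x q\<bar> ^ k)) \<partial>M)"
    by (rule nn_integral_mono_AE)
  also have "\<dots> = ennreal (real (card ?P) ^ k) * (\<Sum>q\<in>?P. \<integral>\<^sup>+x. ennreal (\<bar>?a x q\<bar> ^ k) \<partial>M)"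
    using am by (simp only: nn_integral_cmult nn_integral_sum borel_measurable_sum)
  also have "\<dots> \<le> ennreal (real (card ?P) ^ k) * (\<Sum>q\<in>?P. ennreal (c * p))"
  proof (intro mult_left_mono sum_mono)
    fix q assume "q \<in> ?P"
    then obtain i j where q: "q = (i, j)" and ij: "i \<in> {1..m}" "j \<in> {1..m}" "i \<noteq> j"
      by (cases q) auto
    have "(\<integral>\<^sup>+x. ennreal (\<bar>?a x q\<bar> ^ k) \<partial>M)
        \<le> ennreal c * (\<integral>\<^sup>+x. ennreal (\<bar>L x i * L x j\<bar> ^ k) \<partial>M)"
      unfolding q split by (rule sphere_pair_moment[OF ind ij unit[OF ij(1)] c[OF ij(2)]])
    also have "\<dots> \<le> ennreal c * ennreal p"
      by (intro mult_left_mono p ij) simp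
    finally show "(\<integral>\<^sup>+x. ennreal (\<bar>?a x q\<bar> ^ k) \<partial>M) \<le> ennreal (c * p)"
      using nonneg by (simp add: ennreal_mult)
  qed simp
  also have "\<dots> = ennreal (real (card ?P) ^ (k + 1) * (c * p))"
    using nonneg by (simp add: ennreal_mult mult_ac ennreal_of_nat_eq_real_of_nat)
  also have "\<dots> \<le> ennreal ((real m ^ 2) ^ (k + 1) * (c * p))"
    using nonneg card by (intro ennreal_leI mult_right_mono power_mono) auto
  also have "(real m ^ 2) ^ (k + 1) = real m ^ (2 * k + 2)"
    by (subst power_mult[symmetric]) (simp only: distrib_left mult_1_right)
  finally show "(\<integral>\<^sup>+x. ennreal (\<bar>X x\<bar> ^ k) \<partial>M) \<le> ennreal (real m ^ (2 * k + 2) * (c * p))" .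
qed

section \<open>Almost sure convergence\<close>

text \<open>
  The series of the powers \<open>\<bar>f n\<bar> ^ k\<close> has a finite integral, so it converges almost everywhere and
  its terms tend to zero. This plays the role of Markov's inequality followed by Borel-Cantelli.
\<close>

lemma AE_tendsto_0_if_summable_moments:
  fixes f :: "nat \<Rightarrow> 'a \<Rightarrow> real"
  assumes meas[measurable]: "\<And>n. f n \<in> borel_measurable M" and k: "k \<ge> 1"
    and b: "\<And>n. (\<integral>\<^sup>+x. ennreal (\<bar>f n x\<bar> ^ k) \<partial>M) \<le> ennreal (b n)" "\<And>n. b n \<ge> 0" "summable b"
  shows "AE x in M. (\<lambda>n. f n x) \<longlonglongrightarrow> 0"
proof -
  have "(\<integral>\<^sup>+x. (\<Sum>n. ennreal (\<bar>f n x\<bar> ^ k)) \<partial>M) = (\<Sum>n. \<integral>\<^sup>+x. ennreal (\<bar>f n x\<bar> ^ k) \<partial>M)"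
    by (rule nn_integral_suminf) measurable
  also have "\<dots> \<le> (\<Sum>n. ennreal (b n))"
    by (intro suminf_le b) auto
  also have "\<dots> = ennreal (\<Sum>n. b n)"
    using b by (intro suminf_ennreal_eq) (auto intro: summable_sums)
  finally have "(\<integral>\<^sup>+x. (\<Sum>n. ennreal (\<bar>f n x\<bar> ^ k)) \<partial>M) \<noteq> \<infinity>"
    by (auto simp: top_unique)
  then have "AE x in M. (\<Sum>n. ennreal (\<bar>f n x\<bar> ^ k)) \<noteq> \<infinity>"
    by (intro nn_integral_PInf_AE) measurable
  then show ?thesis
  proof eventually_elim
    case (elim x)
    then have "summable (\<lambda>n. \<bar>f n x\<bar> ^ k)"
      by (intro summable_suminf_not_top) auto
    then have "(\<lambda>n. \<bar>f n x\<bar> ^ k) \<longlonglongrightarrow> 0"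
      by (rule summable_LIMSEQ_zero)
    then have "(\<lambda>n. root k (\<bar>f n x\<bar> ^ k)) \<longlonglongrightarrow> root k 0"
      by (rule tendsto_real_root)
    then show ?case
      using k by (simp add: real_root_power_cancel tendsto_rabs_zero_iff)
  qed
qed

theorem theorem5p6:
  fixes M :: "'a measure"
    and n :: "nat \<Rightarrow> nat"
    and U :: "nat \<Rightarrow> nat \<Rightarrow> 'a \<Rightarrow> nat \<Rightarrow> real"
    and L :: "nat \<Rightarrow> 'a \<Rightarrow> nat \<Rightarrow> real"
    and k :: nat and \<delta> \<gamma> :: real and \<psi> :: "real \<Rightarrow> real"
  assumes "prob_space M" and "complete_measure M"
    and "\<And>d. d \<ge> 2 \<Longrightarrow> n d \<ge> 1" and "mono_on {2..} n"
    and "\<And>d i. d \<ge> 2 \<Longrightarrow> i \<in> {1..n d} \<Longrightarrow> unif_sphere M d (U d i)"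
    and "\<And>d. d \<ge> 2 \<Longrightarrow> L d \<in> measurable M (Rvec (n d))"
    and "\<And>d i \<omega>. d \<ge> 2 \<Longrightarrow> i \<in> {1..n d} \<Longrightarrow> \<omega> \<in> space M \<Longrightarrow> L d \<omega> i \<ge> 0"
    \<comment> \<open>mutual independence of the \<open>n d + 1\<close> vectors; index 0 stands for \<open>L d\<close>\<close>
    and "\<And>d. d \<ge> 2 \<Longrightarrow>
           prob_space.indep_vars M (\<lambda>i. if i = 0 then Rvec (n d) else Rvec d)
             (\<lambda>i. if i = 0 then L d else U d i) {0..n d}"
    and "k \<ge> 1" and "\<delta> \<in> {0<..<1/2}" and "\<And>x. x \<ge> 0 \<Longrightarrow> \<psi> x \<ge> 0"
    and "\<And>d i j. d \<ge> 2 \<Longrightarrow> i \<in> {1..n d} \<Longrightarrow> j \<in> {1..n d} \<Longrightarrow> i \<noteq> j \<Longrightarrow>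
           (\<integral>\<^sup>+\<omega>. ennreal ((L d \<omega> i * L d \<omega> j) ^ k) \<partial>M) \<le> ennreal (\<psi> (real d))"
    and "\<gamma> > 0"
    and "(\<lambda>d. real d powr (1 + \<gamma> - (1/2 - \<delta>) * real k) * \<psi> (real d) * real (n d) ^ (2 * k + 2))
           \<longlonglongrightarrow> 0"
    and "(\<lambda>d. real d powr (1 + \<gamma>) * (real (n d))\<^sup>2 *
              exp (- ((real d - 3) / (2 * real d powr (1 - \<delta>))))) \<longlonglongrightarrow> 0"
  shows "measure M {\<omega> \<in> space M.
           (\<lambda>d. (norm2 d (rsum d (n d) (L d \<omega>) (\<lambda>i. U d i \<omega>)))\<^sup>2 - (norm2 (n d) (L d \<omega>))\<^sup>2)
             \<longlonglongrightarrow> 0} = 1"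
proof -
  interpret prob_space M by fact
  note unif = assms(5) and indep = assms(8) and k = assms(9) and \<psi>0 = assms(11)
  have \<delta>: "0 < \<delta>" "\<delta> < 1/2" using assms(10) by auto
  let ?X = "\<lambda>d \<omega>. (norm2 d (rsum d (n d) (L d \<omega>) (\<lambda>i. U d i \<omega>)))\<^sup>2 - (norm2 (n d) (L d \<omega>))\<^sup>2"
  obtain C :: real where C: "C \<ge> 0"
    "\<And>(M :: 'a measure) d V u. \<lbrakk>unif_sphere M d V; d \<ge> 1; (\<Sum>j=1..d. (u j)\<^sup>2) \<le> 1\<rbrakk> \<Longrightarrow>
       (\<integral>\<^sup>+x. ennreal (\<bar>\<Sum>j=1..d. u j * V x j\<bar> ^ k) \<partial>M) \<le> ennreal (C * real d powr - (real k / 2))"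
    by (rule unif_sphere_linear_form_moment[where 'a = 'a and k = k], rule that)
  have X: "?X d \<in> borel_measurable M"
      "(\<integral>\<^sup>+\<omega>. ennreal (\<bar>?X d \<omega>\<bar> ^ k) \<partial>M)
        \<le> ennreal (real (n d) ^ (2 * k + 2) * (C * real d powr - (real k / 2) * \<psi> (real d)))"
    if d: "d \<ge> 2" for d
  proof -
    have p: "(\<integral>\<^sup>+\<omega>. ennreal (\<bar>L d \<omega> i * L d \<omega> j\<bar> ^ k) \<partial>M) \<le> ennreal (\<psi> (real d))"
      if ij: "i \<in> {1..n d}" "j \<in> {1..n d}" "i \<noteq> j" for i j
    proof -
      have "(\<integral>\<^sup>+\<omega>. ennreal (\<bar>L d \<omega> i * L d \<omega> j\<bar> ^ k) \<partial>M)
          = (\<integral>\<^sup>+\<omega>. ennreal ((L d \<omega> i * L d \<omega> j) ^ k) \<partial>M)"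
        using assms(7)[OF d] ij by (intro nn_integral_cong) (simp add: abs_mult)
      also have "\<dots> \<le> ennreal (\<psi> (real d))"
        by (rule assms(12)[OF d ij])
      finally show ?thesis .
    qed
    have d1: "d \<ge> 1" using d by simp
    note unit = unif_sphere_AE_norm[OF unif[OF d] d1] and lin = C(2)[OF unif[OF d] d1]
    have "C * real d powr - (real k / 2) \<ge> 0" "\<psi> (real d) \<ge> 0"
      using C(1) \<psi>0 by simp_all
    from spherical_sum_excess_moment[OF indep[OF d] unit lin p k this]
    show "?X d \<in> borel_measurable M"
      "(\<integral>\<^sup>+\<omega>. ennreal (\<bar>?X d \<omega>\<bar> ^ k) \<partial>M)
        \<le> ennreal (real (n d) ^ (2 * k + 2) * (C * real d powr - (real k / 2) * \<psi> (real d)))"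
      by simp_all
  qed
  let ?t = "\<lambda>d. real d powr (1 + \<gamma> - (1/2 - \<delta>) * real k) * \<psi> (real d) * real (n d) ^ (2 * k + 2)"
  have "\<forall>\<^sub>F d in sequentially. ?t d < 1"
    using assms(14) by (rule order_tendstoD) simp
  then obtain N where N: "\<And>d. d \<ge> N \<Longrightarrow> ?t d < 1"
    by (auto simp: eventually_sequentially)
  \<comment> \<open>The shift by 2 keeps the dimension in the range of the hypotheses.\<close>
  define K where "K = N + 2"
  have le: "(\<integral>\<^sup>+\<omega>. ennreal (\<bar>?X (d + K) \<omega>\<bar> ^ k) \<partial>M) \<le> ennreal (C * real (d + K) powr - (1 + \<gamma>))" for d
  proof -
    let ?d = "d + K"
    have d: "?d \<ge> 2" "?d \<ge> N" by (simp_all add: K_def)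
    \<comment> \<open>The spherical factor \<open>d powr - (k / 2)\<close> is stronger than the required \<open>d powr - ((1/2 - \<delta>) * k)\<close>.\<close>
    have "real ?d powr - (real k / 2) \<le> real ?d powr (- (1 + \<gamma>) + (1 + \<gamma> - (1/2 - \<delta>) * real k))"
      using d \<delta> by (intro powr_mono) (auto simp: algebra_simps)
    then have "real ?d powr - (real k / 2) * (\<psi> (real ?d) * real (n ?d) ^ (2 * k + 2))
        \<le> real ?d powr (- (1 + \<gamma>) + (1 + \<gamma> - (1/2 - \<delta>) * real k)) *
            (\<psi> (real ?d) * real (n ?d) ^ (2 * k + 2))"
      using \<psi>0[of "real ?d"] by (intro mult_right_mono) auto
    also have "\<dots> = real ?d powr - (1 + \<gamma>) * ?t ?d"
      unfolding powr_add by (simp only: mult.assoc)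
    also have "\<dots> \<le> real ?d powr - (1 + \<gamma>)"
      using N[OF d(2)] by (intro mult_left_le) auto
    finally have "C * (real ?d powr - (real k / 2) * (\<psi> (real ?d) * real (n ?d) ^ (2 * k + 2)))
        \<le> C * real ?d powr - (1 + \<gamma>)"
      using C(1) by (rule mult_left_mono)
    then have "real (n ?d) ^ (2 * k + 2) * (C * real ?d powr - (real k / 2) * \<psi> (real ?d))
        \<le> C * real ?d powr - (1 + \<gamma>)"
      by (simp only: mult_ac)
    with X(2)[OF d(1)] show ?thesis
      by (meson ennreal_leI order_trans)
  qed
  have "summable (\<lambda>d. real d powr - (1 + \<gamma>))"
    using assms(13) by (subst summable_real_powr_iff) simp
  then have "summable (\<lambda>d. C * real (d + K) powr - (1 + \<gamma>))"
    by (intro summable_mult summable_ignore_initial_segment)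
  moreover have "C * real (d + K) powr - (1 + \<gamma>) \<ge> 0" for d
    using C(1) by simp
  moreover have XK: "?X (d + K) \<in> borel_measurable M" for d
    by (rule X(1)) (simp add: K_def)
  ultimately have "AE \<omega> in M. (\<lambda>d. ?X (d + K) \<omega>) \<longlonglongrightarrow> 0"
    by (intro AE_tendsto_0_if_summable_moments[OF XK k le])
  moreover have "{\<omega> \<in> space M. (\<lambda>d. ?X (d + K) \<omega>) \<longlonglongrightarrow> 0} \<in> sets M"
    using XK by measurable
  ultimately have "measure M {\<omega> \<in> space M. (\<lambda>d. ?X (d + K) \<omega>) \<longlonglongrightarrow> 0} = 1"
    by (subst prob_Collect_eq_1) auto
  moreover have "(\<lambda>d. ?X (d + K) \<omega>) \<longlonglongrightarrow> 0 \<longleftrightarrow> (\<lambda>d. ?X d \<omega>) \<longlonglongrightarrow> 0" for \<omega>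
    by (rule iffI) (erule LIMSEQ_offset, erule LIMSEQ_ignore_initial_segment)
  ultimately show ?thesis by simp
qed

end
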